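(* For every integer $n>1$, the number of minimal forbidden words of length $n$ for the language $St$ of finite Sturmian words over the alphabet $\{a,b\}$ is exactly $2(n-1-\phi(n))$, where $\phi$ is the Euler totient function.
   Context: Words are finite and over the alphabet $\Sigma=\{a,b\}$; $|u|_a$ is the number of occurrences of the letter $a$ in $u$; a factor is a contiguous subword. A word $w\in\Sigma^*$ is Sturmian if it is balanced: for any two factors $u,v$ of $w$ of the same length, $\big||u|_a-|v|_a\big|\le 1$. Let $St$ be the set of (finite) Sturmian words. A word $w\in\Sigma^*$ is a minimal forbidden word for a factorial language $L\subseteq\Sigma^*$ (one closed under taking factors) if $w\notin L$ but every proper factor of $w$ belongs to $L$; i.e. the set of minimal forbidden words for $L$ is $\Sigma L\cap L\Sigma\cap(\Sigma^*\setminus L)$. $\phi(m)$ is the number of positive integers smaller than or equal to $m$ and coprime with $m$. *)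

theory Defs
  imports Main "HOL-Library.Sublist" "HOL-Number_Theory.Totient"
begin

datatype letter = A | B

type_synonym word = "letter list"

text \<open>
  A factor (contiguous subword) is a \<^const>\<open>sublist\<close>, a proper factor a \<^const>\<open>strict_sublist\<close>.
\<close>

definition factorial_language :: "word set \<Rightarrow> bool" where
  "factorial_language L \<longleftrightarrow> (\<forall>w \<in> L. \<forall>u. sublist u w \<longrightarrow> u \<in> L)"

definition balanced :: "word \<Rightarrow> bool" where
  "balanced w \<longleftrightarrow>
     (\<forall>u v. sublist u w \<and> sublist v w \<and> length u = length v
        \<longrightarrow> \<bar>int (count_list u A) - int (count_list v A)\<bar> \<le> 1)"

definition St :: "word set" where
  "St = {w. balanced w}"

definition minimal_forbidden_words :: "word set \<Rightarrow> word set" where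
  "minimal_forbidden_words L = {w. w \<notin> L \<and> (\<forall>u. strict_sublist u w \<longrightarrow> u \<in> L)}"

lemma factorial_language_St: "factorial_language St"
  unfolding factorial_language_def St_def balanced_def
  by (blast intro: sublist_order.order.trans)

text \<open>
  For a nonempty factorial language, the minimal forbidden words form the set
  \<open>\<Sigma>L \<inter> L\<Sigma> \<inter> (\<Sigma>\<^sup>* - L)\<close>.
\<close>

lemma minimal_forbidden_words_factorial:
  assumes "factorial_language L" and "L \<noteq> {}"
  shows "minimal_forbidden_words L =
    {x # w |x w. w \<in> L} \<inter> {w @ [x] |x w. w \<in> L} \<inter> (UNIV - L)" (is "_ = ?R")
proof (intro equalityI subsetI)
  fix w assume w: "w \<in> minimal_forbidden_words L"
  have "[] \<in> L"
    using assms unfolding factorial_language_def by auto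
  with w have ne: "w \<noteq> []" unfolding minimal_forbidden_words_def by auto
  then have "length (tl w) \<noteq> length w" "length (butlast w) \<noteq> length w"
    by (cases w; simp)+
  then have "strict_sublist (tl w) w" "strict_sublist (butlast w) w"
    unfolding strict_sublist_def by (metis sublist_tl, metis sublist_butlast)
  with w have "tl w \<in> L" "butlast w \<in> L" "w \<notin> L"
    unfolding minimal_forbidden_words_def by auto
  moreover have "w = hd w # tl w" "w = butlast w @ [last w]" using ne by auto
  ultimately show "w \<in> ?R" by blast
next
  fix w assume "w \<in> ?R"
  then obtain x u y v where w: "w = x # u" "u \<in> L" "w = v @ [y]" "v \<in> L" "w \<notin> L" by blast
  have "s \<in> L" if s: "strict_sublist s w" for s
  proof -
    from s obtain ps ss where eq: "w = ps @ s @ ss" and "s \<noteq> w"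
      by (auto simp: strict_sublist_def sublist_def)
    have "sublist s u \<or> sublist s v"
    proof (cases ps)
      case Nil
      with eq \<open>s \<noteq> w\<close> have "ss \<noteq> []" by auto
      then have "v = s @ butlast ss"
        using eq Nil w(3) by (metis append_Nil butlast_append butlast_snoc)
      then show ?thesis by auto
    next
      case (Cons p ps')
      with eq w(1) have "u = ps' @ s @ ss" by auto
      then show ?thesis by auto
    qed
    with w assms(1) show ?thesis unfolding factorial_language_def by blast
  qed
  with w show "w \<in> minimal_forbidden_words L" unfolding minimal_forbidden_words_def by blast
qed

end

theory Submission imports Defs begin

text \<open>
  Let \<open>h i\<close> count the letters \<open>A\<close> among the first \<open>i\<close> letters of \<open>w\<close>, where \<open>w\<close> has length \<open>n\<close> and
  \<open>p = h n\<close>. In a minimal forbidden word only a prefix and a suffix of equal length can violate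
  balance; up to reversal the prefix has two more letters \<open>A\<close> than the suffix. For the shortest such
  length \<open>k\<close>, all other factors of length \<open>k\<close> have the count \<open>h k - 1\<close>, so the interior of \<open>w\<close> has
  period \<open>k\<close>; minimality gives \<open>k dvd n\<close>, and averaging the counts of interior factors over one
  period forces \<open>h i = \<lfloor>i * p / n\<rfloor> + 1\<close> for \<open>0 < i < n\<close>. Conversely these heights define a minimal
  forbidden word exactly when \<open>p\<close> and \<open>n\<close> are not coprime, which leaves \<open>n - 1 - totient n\<close> choices
  of \<open>p\<close>, each counted with its reversal.
\<close>

section \<open>Prefix counts of a word\<close>

definition height :: "word \<Rightarrow> nat \<Rightarrow> int" where
  "height w i = int (count_list (take i w) A)"

lemma height_0 [simp]: "height w 0 = 0"
  by (simp add: height_def)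

lemma height_Suc:
  "i < length w \<Longrightarrow> height w (Suc i) = height w i + (if w ! i = A then 1 else 0)"
  by (simp add: height_def take_Suc_conv_app_nth)

lemma count_factor: "int (count_list (take k (drop i w)) A) = height w (i + k) - height w i"
  by (simp add: height_def take_add)

lemma height_rev:
  assumes "i \<le> length w"
  shows "height (rev w) i = height w (length w) - height w (length w - i)"
proof -
  have "height w (length w) = height w (length w - i) + int (count_list (drop (length w - i) w) A)"
    unfolding height_def
    by (metis append_take_drop_id count_list_append of_nat_add take_all order_refl)
  then show ?thesis
    by (simp add: height_def take_rev)
qed

lemma height_inject:
  assumes "length v = length w" "\<And>i. i \<le> length w \<Longrightarrow> height v i = height w i"
  shows "v = w"
proof (rule nth_equalityI)
  fix i assume "i < length v"
  then have "(v ! i = A) = (w ! i = A)"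
    using assms(1) assms(2)[of i] assms(2)[of "Suc i"] height_Suc[of i v] height_Suc[of i w]
    by (auto split: if_splits)
  then show "v ! i = w ! i"
    by (cases "v ! i"; cases "w ! i") auto
qed (use assms in simp)

section \<open>Balance and minimality in terms of heights\<close>

lemma factor_iff:
  "sublist u w \<longleftrightarrow> (\<exists>i. i + length u \<le> length w \<and> u = take (length u) (drop i w))"
proof
  assume "sublist u w"
  then obtain ps ss where "w = ps @ u @ ss" by (auto simp: sublist_def)
  then show "\<exists>i. i + length u \<le> length w \<and> u = take (length u) (drop i w)"
    by (intro exI[of _ "length ps"]) simp
next
  assume "\<exists>i. i + length u \<le> length w \<and> u = take (length u) (drop i w)"
  then show "sublist u w"
    by (metis sublist_take sublist_drop sublist_order.order.trans)
qed

lemma balanced_iff_height: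
  "balanced w \<longleftrightarrow> (\<forall>i j k. i + k \<le> length w \<longrightarrow> j + k \<le> length w \<longrightarrow>
     \<bar>(height w (i + k) - height w i) - (height w (j + k) - height w j)\<bar> \<le> 1)"
    (is "_ \<longleftrightarrow> ?R")
proof
  assume bal: "balanced w"
  show ?R
  proof (intro allI impI)
    fix i j k assume "i + k \<le> length w" "j + k \<le> length w"
    then have "length (take k (drop i w)) = length (take k (drop j w))" by simp
    moreover have "sublist (take k (drop i w)) w" "sublist (take k (drop j w)) w"
      by (meson sublist_take sublist_drop sublist_order.order.trans)+
    ultimately show
      "\<bar>(height w (i + k) - height w i) - (height w (j + k) - height w j)\<bar> \<le> 1"
      using bal unfolding balanced_def count_factor[symmetric] by blast
  qed
next
  assume R: ?R
  show "balanced w" unfolding balanced_def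
  proof (intro allI impI, elim conjE)
    fix u v assume "sublist u w" "sublist v w" and len: "length u = length v"
    then obtain i j where ij: "i + length u \<le> length w" "j + length u \<le> length w"
      and uv: "u = take (length u) (drop i w)" "v = take (length u) (drop j w)"
      unfolding factor_iff by metis
    show "\<bar>int (count_list u A) - int (count_list v A)\<bar> \<le> 1"
      using R[rule_format, OF ij] uv count_factor[of "length u"] by metis
  qed
qed

text \<open>A proper factor misses the first or the last letter, so it lies in \<open>tl w\<close>
  or \<open>butlast w\<close>.\<close>

lemma minimal_forbidden_iff_ends:
  "w \<in> minimal_forbidden_words St \<longleftrightarrow> \<not> balanced w \<and> balanced (tl w) \<and> balanced (butlast w)"
proof -
  have nil: "balanced []" by (simp add: balanced_def)
  then have "St \<noteq> {}" by (auto simp: St_def)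
  have head: "(\<exists>x u. w = x # u \<and> balanced u) \<longleftrightarrow> w \<noteq> [] \<and> balanced (tl w)"
    by (cases w) auto
  have last: "(\<exists>x u. w = u @ [x] \<and> balanced u) \<longleftrightarrow> w \<noteq> [] \<and> balanced (butlast w)"
    by (cases w rule: rev_cases) auto
  show ?thesis
    unfolding minimal_forbidden_words_factorial[OF factorial_language_St \<open>St \<noteq> {}\<close>]
    unfolding St_def using nil head last by auto
qed

lemma height_tl: "height (tl w) i = height w (Suc i) - height w 1"
  using count_factor[of i 1 w] by (simp add: height_def drop_Suc)

lemma height_butlast: "i < length w \<Longrightarrow> height (butlast w) i = height w i"
  by (simp add: height_def take_butlast)

lemma balanced_tl_iff:
  "balanced (tl w) \<longleftrightarrow> (\<forall>i j k. 0 < i \<longrightarrow> 0 < j \<longrightarrow> i + k \<le> length w \<longrightarrow> j + k \<le> length w \<longrightarrow>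
     \<bar>(height w (i + k) - height w i) - (height w (j + k) - height w j)\<bar> \<le> 1)"
    (is "_ \<longleftrightarrow> ?R")
proof (cases "w = []")
  case False
  show ?thesis
  proof
    assume bal: "balanced (tl w)"
    show ?R
    proof (intro allI impI)
      fix i j k assume "0 < i" "0 < j" "i + k \<le> length w" "j + k \<le> length w"
      then show "\<bar>(height w (i + k) - height w i) - (height w (j + k) - height w j)\<bar> \<le> 1"
        using bal[unfolded balanced_iff_height, rule_format, of "i - 1" k "j - 1"]
        by (simp add: height_tl)
    qed
  next
    assume R: ?R
    show "balanced (tl w)" unfolding balanced_iff_height
    proof (intro allI impI)
      fix i j k assume "i + k \<le> length (tl w)" "j + k \<le> length (tl w)"
      then have "Suc i + k \<le> length w" "Suc j + k \<le> length w"
        using False by (cases w; simp)+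
      then show "\<bar>(height (tl w) (i + k) - height (tl w) i)
          - (height (tl w) (j + k) - height (tl w) j)\<bar> \<le> 1"
        using R[rule_format, of "Suc i" "Suc j" k] False
        by (simp add: height_tl )
    qed
  qed
qed (simp add: balanced_def)

lemma balanced_butlast_iff:
  "balanced (butlast w) \<longleftrightarrow> (\<forall>i j k. i + k < length w \<longrightarrow> j + k < length w \<longrightarrow>
     \<bar>(height w (i + k) - height w i) - (height w (j + k) - height w j)\<bar> \<le> 1)"
proof (cases "w = []")
  case False
  then have le: "x \<le> length (butlast w) \<longleftrightarrow> x < length w" for x
    by (cases w rule: rev_cases) auto
  show ?thesis
    unfolding balanced_iff_height le by (intro all_cong1 imp_cong refl) (simp add: height_butlast)
qed (simp add: balanced_def)

lemma balanced_rev: "balanced (rev w) \<longleftrightarrow> balanced w"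
proof -
  have "balanced (rev v)" if "balanced v" for v
    unfolding balanced_def
  proof (intro allI impI, elim conjE)
    fix s t assume "sublist s (rev v)" "sublist t (rev v)" "length s = length t"
    then show "\<bar>int (count_list s A) - int (count_list t A)\<bar> \<le> 1"
      using that[unfolded balanced_def, rule_format, of "rev s" "rev t"]
      by (simp add: sublist_rev_right)
  qed
  from this[of w] this[of "rev w"] show ?thesis by auto
qed

text \<open>Reversal preserves balance and exchanges \<open>tl\<close> and
  \<open>butlast\<close>.\<close>

lemma minimal_forbidden_rev:
  "rev w \<in> minimal_forbidden_words St \<longleftrightarrow> w \<in> minimal_forbidden_words St"
proof -
  have "balanced (tl (rev w)) = balanced (butlast w)" "balanced (butlast (rev w)) = balanced (tl w)"
    by (metis balanced_rev butlast_rev rev_rev_ident)+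
  then show ?thesis
    by (auto simp: minimal_forbidden_iff_ends balanced_rev)
qed

section \<open>Heights forced by an unbalanced prefix and suffix\<close>

text \<open>
  The bound on \<open>h i\<close> in the conclusion says \<open>h i = \<lfloor>i * h n / n\<rfloor> + 1\<close>.
\<close>

lemma unbalanced_height_form:
  fixes h :: "nat \<Rightarrow> int"
  assumes h0: "h 0 = 0"
    and step: "\<And>i. i < n \<Longrightarrow> h i \<le> h (Suc i) \<and> h (Suc i) \<le> h i + 1"
    and inner: "\<And>i j l. 0 < i \<Longrightarrow> 0 < j \<Longrightarrow> i + l \<le> n \<Longrightarrow> j + l \<le> n \<Longrightarrow>
        \<bar>(h (i + l) - h i) - (h (j + l) - h j)\<bar> \<le> 1"
    and outer: "\<And>i j l. i + l < n \<Longrightarrow> j + l < n \<Longrightarrow>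
        \<bar>(h (i + l) - h i) - (h (j + l) - h j)\<bar> \<le> 1"
    and ex: "\<exists>k<n. h k - (h n - h (n - k)) \<ge> 2"
  obtains d where "d > 1" "d dvd n" "int d dvd h n"
    "\<And>i. 0 < i \<Longrightarrow> i < n \<Longrightarrow> int n * (h i - 1) \<le> int i * h n \<and> int i * h n < int n * h i"
proof -
  define D where "D k = h k - (h n - h (n - k))" for k
  have "\<exists>k. k < n \<and> D k \<ge> 2" using ex by (auto simp: D_def)
  then obtain k where k: "k < n" "D k \<ge> 2" and least: "\<And>j. j < k \<Longrightarrow> \<not> (j < n \<and> D j \<ge> 2)"
    using exists_least_iff[of "\<lambda>k. k < n \<and> D k \<ge> 2"] by blast
  have k0: "k > 0" using k h0 by (auto simp: D_def intro: Nat.gr0I)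
  have Dsym: "D (n - j) = D j" if "j \<le> n" for j
    using that by (simp add: D_def)
  \<comment> \<open>Single letters differ by at most one; the symmetry of \<open>D\<close> then
    rules out \<open>k = n - 1\<close>, so interior factors of length \<open>k\<close>
    exist.\<close>
  have "D 1 \<le> 1"
    using step[of 0] step[of "n - 1"] k k0 h0 by (simp add: D_def)
  then have kn: "k + 1 < n"
    using k Dsym[of k] by (cases "n = k + 1") auto
  \<comment> \<open>\<open>m\<close> is the count of every interior factor of length
    \<open>k\<close>: the prefix bounds it from below, the suffix from above, and
    \<open>D k \<ge> 2\<close> makes the bounds meet.\<close>
  define m where "m = h k - 1"
  have interior: "h (i + k) - h i = m" if "0 < i" "i + k < n" for i
  proof -
    have "h k - h 0 \<le> h (i + k) - h i + 1"
      using outer[of 0 k i] that k by simp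
    moreover have "h (i + k) - h i \<le> h n - h (n - k) + 1"
      using inner[of i "n - k" k] that k by simp
    ultimately show ?thesis using k(2) h0 by (simp add: D_def m_def)
  qed
  \<comment> \<open>Prefix and suffix each grow by an interior factor of length \<open>k\<close>,
    with count \<open>m\<close> both times.\<close>
  have Dk: "D (j + k) = D j" if "0 < j" "j + k < n" for j
  proof -
    have "h (n - j) - h (n - (j + k)) = m"
      using interior[of "n - (j + k)"] that by simp
    then show ?thesis using interior[OF that] by (simp add: D_def)
  qed
  \<comment> \<open>\<open>D\<close> has period \<open>k\<close> and is symmetric, so a nonzero remainder would satisfy
     \<open>D (n mod k) = D (n - k) = D k\<close>, against minimality.\<close>
  have "n mod k = 0"
  proof (rule ccontr)
    assume r: "n mod k \<noteq> 0"
    have *: "D (n mod k + t * k) = D (n mod k)" if "n mod k + t * k < n" for t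
      using that
    proof (induction t)
      case (Suc t)
      then show ?case using Dk[of "n mod k + t * k"] r by (simp add: algebra_simps)
    qed simp
    obtain q where q: "n div k = Suc q"
      using k k0 by (metis div_greater_zero_iff gr0_implies_Suc less_imp_le)
    have "n = n mod k + Suc q * k" using q by (metis mod_mult_div_eq mult.commute)
    then have nk: "n mod k + q * k = n - k" by simp
    then have "D (n mod k) \<ge> 2"
      using *[of q] k k0 Dsym[of k] by simp
    then show False
      using least[of "n mod k"] k0 k by (meson mod_less_divisor less_trans)
  qed
  then obtain q where q: "n = q * k" by (metis dvdE mod_eq_0_iff_dvd mult.commute)
  have q2: "q \<ge> 2" using q k k0 by (cases q; cases "q - 1") auto
  have hmult: "h (i + t * k) = h i + int t * m" if "0 < i" "i + t * k < n" for i t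
    using that
  proof (induction t)
    case (Suc t)
    then show ?case using interior[of "i + t * k"] by (simp add: algebra_simps)
  qed simp
  \<comment> \<open>The \<open>q\<close> blocks of length \<open>k\<close> have counts
    \<open>m + 1\<close>, then \<open>q - 2\<close> times \<open>m\<close>, then
    \<open>m - 1\<close>.\<close>
  have "h (k + (q - 2) * k) = h k + int (q - 2) * m"
    using hmult[of k "q - 2"] k0 q2 q by (simp add: algebra_simps diff_mult_distrib)
  moreover have "k + (q - 2) * k = n - k"
    using q2 by (simp add: q diff_mult_distrib)
  moreover have "D k = 2"
    using interior[of 1] kn outer[of 0 k 1] inner[of 1 "n - k" k] k h0 by (simp add: D_def)
  ultimately have hn: "h n = int q * m"
    using q2 by (simp add: D_def m_def of_nat_diff algebra_simps)
  have "k + k \<le> n" using q q2 by (metis mult_2 mult_le_mono1)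
  \<comment> \<open>Raising \<open>i\<close> by one lengthens the \<open>k\<close> factors by the
    letters of one interior factor of length \<open>k\<close>, which adds \<open>m\<close> to the
    sum.\<close>
  have total: "(\<Sum>s=1..k. h (s + i) - h s) = int i * m" if "i < k" for i
    using that
  proof (induction i)
    case (Suc i)
    have "(\<Sum>s=1..k. h (s + Suc i) - h s) = (\<Sum>s=1..k. h (s + i) - h s)
        + (\<Sum>s=1..k. h (Suc (s + i)) - h (s + i))"
      by (simp flip: sum.distrib)
    also have "(\<Sum>s=1..k. h (Suc (s + i)) - h (s + i)) = h (Suc k + i) - h (1 + i)"
      using sum_Suc_diff[of 1 k "\<lambda>s. h (s + i)"] k0 by simp
    also have "\<dots> = m"
      using interior[of "1 + i"] Suc.prems \<open>k + k \<le> n\<close> by (simp add: algebra_simps)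
    finally show ?case using Suc by (simp add: algebra_simps)
  qed simp
  have base: "int k * (h i - 1) \<le> int i * m \<and> int i * m < int k * h i" if i: "0 < i" "i < k" for i
  proof
    have "(\<Sum>s=1..k. h i - 1) \<le> (\<Sum>s=1..k. h (s + i) - h s)"
    proof (rule sum_mono)
      fix s assume "s \<in> {1..k}"
      then show "h i - 1 \<le> h (s + i) - h s"
        using outer[of 0 i s] i \<open>k + k \<le> n\<close> h0 by simp
    qed
    then show "int k * (h i - 1) \<le> int i * m"
      using total[OF i(2)] by simp
    \<comment> \<open>Here the averaged factors have the length \<open>k - i\<close> of the factor from \<open>i\<close> to \<open>k\<close>.\<close>
    define c where "c = h k - h i"
    have "(\<Sum>s=1..k. c - 1) < (\<Sum>s=1..k. h (s + (k - i)) - h s)"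
    proof (rule sum_strict_mono_ex1)
      show "\<forall>s\<in>{1..k}. c - 1 \<le> h (s + (k - i)) - h s"
      proof
        fix s assume "s \<in> {1..k}"
        then show "c - 1 \<le> h (s + (k - i)) - h s"
          using inner[of i s "k - i"] i \<open>k + k \<le> n\<close> by (auto simp: c_def le_diff_conv)
      qed
      \<comment> \<open>The start \<open>s = i\<close> yields the count \<open>c\<close> itself,
        which makes the inequality of sums strict.\<close>
      show "\<exists>s\<in>{1..k}. c - 1 < h (s + (k - i)) - h s"
        using i by (intro bexI[of _ i]) (auto simp: c_def)
    qed simp
    then have "int k * (m - h i) < int (k - i) * m"
      using total[of "k - i"] i by (simp add: c_def m_def algebra_simps)
    then show "int i * m < int k * h i"
      using i by (simp add: of_nat_diff algebra_simps)
  qed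
  \<comment> \<open>Passing from \<open>i - k\<close> to \<open>i\<close> adds \<open>k * m\<close>
    to all terms; at \<open>i = k\<close> the bounds follow from \<open>h k = m + 1\<close>.\<close>
  have all: "int k * (h i - 1) \<le> int i * m \<and> int i * m < int k * h i" if "0 < i" "i < n" for i
    using that
  proof (induction i rule: less_induct)
    case (less i)
    consider "i < k" | "i = k" | "i > k" by linarith
    then show ?case
    proof cases
      case 3
      then show ?thesis
        using less.IH[of "i - k"] less.prems k0 interior[of "i - k"]
        by (simp add: of_nat_diff algebra_simps)
    qed (use base less.prems k0 in \<open>auto simp: m_def algebra_simps\<close>)
  qed
  show thesis
  proof
    show "q > 1" "q dvd n" "int q dvd h n" using q2 q hn by auto
    fix i assume "0 < i" "i < n"
    from all[OF this] have
      "int q * (int k * (h i - 1)) \<le> int q * (int i * m)" "int q * (int i * m) < int q * (int k * h i)"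
      using q2 by (auto intro: mult_left_mono mult_strict_left_mono)
    then show "int n * (h i - 1) \<le> int i * h n \<and> int i * h n < int n * h i"
      unfolding hn unfolding q by (simp only: of_nat_mult ac_simps)
  qed
qed

section \<open>Words with the forced heights\<close>

text \<open>The interior values are those forced by \<open>unbalanced_height_form\<close> for
  \<open>h n = p\<close>. The ends are not raised by one, so for \<open>0 < p < n\<close> the word
  starts with \<open>A\<close> and ends with \<open>B\<close>.\<close>

definition exceptional_height :: "nat \<Rightarrow> nat \<Rightarrow> nat \<Rightarrow> int" where
  "exceptional_height n p i =
     (if i = 0 then 0 else if i = n then int p else int (i * p div n) + 1)"

text \<open>
  Exchanging the first and last letter of this word gives a power of a Christoffel word.
\<close>

definition exceptional_word :: "nat \<Rightarrow> nat \<Rightarrow> word" where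
  "exceptional_word n p = map (\<lambda>i. if exceptional_height n p (Suc i) = exceptional_height n p i
     then B else A) [0..<n]"

lemma length_exceptional_word [simp]: "length (exceptional_word n p) = n"
  by (simp add: exceptional_word_def)

lemma exceptional_height_bounds:
  assumes "0 < i" "i < n"
  shows "int n * (exceptional_height n p i - 1) \<le> int i * int p"
    and "int i * int p < int n * exceptional_height n p i"
proof -
  have "n * (i * p div n) \<le> i * p" "i * p < n * (i * p div n) + n"
    using assms dividend_less_times_div[of n "i * p"] by auto
  then have "int (n * (i * p div n)) \<le> int (i * p)" "int (i * p) < int (n * (i * p div n) + n)"
    by (simp_all only: of_nat_le_iff of_nat_less_iff)
  then show "int n * (exceptional_height n p i - 1) \<le> int i * int p"
    and "int i * int p < int n * exceptional_height n p i"
    using assms by (simp_all add: exceptional_height_def algebra_simps)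
qed

text \<open>Both \<open>x\<close> and \<open>y\<close> are the only integer above
  \<open>c / N\<close> and at most \<open>c / N + 1\<close>.\<close>

lemma height_bounds_unique:
  fixes x y N c :: int
  assumes "N > 0" "N * (x - 1) \<le> c" "c < N * x" "N * (y - 1) \<le> c" "c < N * y"
  shows "x = y"
proof -
  have "N * (x - 1) < N * y" "N * (y - 1) < N * x" using assms by linarith+
  then show ?thesis using assms(1) by (simp add: mult_less_cancel_left)
qed

text \<open>The slope \<open>p / n\<close> lies between 0 and 1, so interior floors grow by 0 or 1;
  at the ends the height rises from 0 to 1 and stays at \<open>p\<close>.\<close>

lemma exceptional_height_step:
  assumes "0 < p" "p < n" "i < n"
  shows "exceptional_height n p (Suc i) = exceptional_height n p i
       \<or> exceptional_height n p (Suc i) = exceptional_height n p i + 1"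
proof -
  let ?H = "exceptional_height n p"
  consider "i = 0" | "0 < i" "Suc i = n" | "0 < i" "Suc i < n" using assms by linarith
  then show ?thesis
  proof cases
    case 1
    then show ?thesis using assms by (simp add: exceptional_height_def)
  next
    case 2
    have "?H i = int p"
    proof (rule height_bounds_unique[of "int n" _ "int i * int p"])
      show "int n * (int p - 1) \<le> int i * int p" "int i * int p < int n * int p"
        using assms 2 by (auto simp: algebra_simps)
    qed (use assms 2 exceptional_height_bounds[of i n p] in auto)
    then show ?thesis using 2 by (simp add: exceptional_height_def)
  next
    case 3
    have "int n * (?H (Suc i) - 1) < int n * (?H i + 1)" "int n * (?H i - 1) < int n * ?H (Suc i)"
      using exceptional_height_bounds[of i n p] exceptional_height_bounds[of "Suc i" n p] 3 assms
      by (auto simp: algebra_simps)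
    then show ?thesis using assms by (simp add: mult_less_cancel_left) linarith
  qed
qed

lemma height_exceptional_word:
  assumes "0 < p" "p < n" "i \<le> n"
  shows "height (exceptional_word n p) i = exceptional_height n p i"
  using assms(3)
proof (induction i)
  case 0
  then show ?case by (simp add: exceptional_height_def)
next
  case (Suc i)
  then show ?case
    using exceptional_height_step[of p n i] assms
    by (auto simp: height_Suc exceptional_word_def)
qed

text \<open>With \<open>d = gcd p n\<close>, the prefix and the suffix of length
  \<open>n div d\<close> have counts strictly above and strictly below the integer
  \<open>p div d\<close>, so they differ by at least 2.\<close>

lemma exceptional_word_minimal_forbidden:
  assumes "0 < p" "p < n" "\<not> coprime p n"
  shows "exceptional_word n p \<in> minimal_forbidden_words St"
proof -
  let ?w = "exceptional_word n p" and ?H = "exceptional_height n p"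
  define N P where "N = int n" and "P = int p"
  have N: "N > 0" using assms by (simp add: N_def)
  have h: "height ?w i = ?H i" if "i \<le> n" for i
    using height_exceptional_word assms that by blast
  have H0: "?H 0 = 0" and Hn: "?H n = P"
    using assms by (auto simp: exceptional_height_def P_def)
  have b: "N * (?H i - 1) \<le> int i * P" "int i * P < N * ?H i" if "0 < i" "i < n" for i
    using exceptional_height_bounds[OF that] by (auto simp: N_def P_def)
  have close: "\<bar>x - y\<bar> \<le> 1" if "N * x < N * y + 2 * N" "N * y < N * x + 2 * N" for x y
  proof -
    have "N * x < N * (y + 2)" "N * y < N * (x + 2)" using that by (auto simp: algebra_simps)
    then show ?thesis using N by (simp add: mult_less_cancel_left)
  qed
  \<comment> \<open>All factors of length \<open>k\<close> avoiding both ends have count within 1 of \<open>k * P / N\<close>;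
     a prefix can only exceed this value and a suffix only fall below it.\<close>
  have mid: "int k * P - N < N * (?H (i + k) - ?H i)" "N * (?H (i + k) - ?H i) < int k * P + N"
    if "0 < i" "i + k < n" for i k
    using b[of i] b[of "i + k"] that by (auto simp: algebra_simps)
  have pre: "int k * P < N * ?H k" "N * ?H k \<le> int k * P + N" if "0 < k" "k < n" for k
    using b[of k] that by (auto simp: algebra_simps)
  have suf: "int k * P - N \<le> N * (?H (i + k) - ?H i)" "N * (?H (i + k) - ?H i) < int k * P"
    if "0 < i" "0 < k" "i + k = n" for i k
  proof -
    have "int i * P = N * P - int k * P" using that(3) by (auto simp: N_def algebra_simps)
    then show "int k * P - N \<le> N * (?H (i + k) - ?H i)" "N * (?H (i + k) - ?H i) < int k * P"
      using b[of i] that Hn by (auto simp: algebra_simps)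
  qed
  have "balanced (tl ?w)"
    unfolding balanced_tl_iff
  proof (intro allI impI)
    fix i j k assume a: "0 < i" "0 < j" "i + k \<le> length ?w" "j + k \<le> length ?w"
    \<comment> \<open>The scaled counts lie in an interval of length \<open>2 * N\<close> that lacks
      one end, so two counts differ by less than 2. For \<open>tl\<close> suffixes may reach the
      lower end, for \<open>butlast\<close> prefixes the upper one.\<close>
    have "int k * P - N \<le> N * (?H (s + k) - ?H s) \<and> N * (?H (s + k) - ?H s) < int k * P + N"
      if "0 < s" "s + k \<le> n" "0 < k" for s
      using mid[of s k] suf[of s k] that N by (cases "s + k = n") auto
    from this[of i] this[of j]
    show "\<bar>height ?w (i + k) - height ?w i - (height ?w (j + k) - height ?w j)\<bar> \<le> 1"
      using a h by (cases "k = 0") (auto intro!: close)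
  qed
  moreover have "balanced (butlast ?w)"
    unfolding balanced_butlast_iff
  proof (intro allI impI)
    fix i j k assume a: "i + k < length ?w" "j + k < length ?w"
    have "int k * P - N < N * (?H (s + k) - ?H s) \<and> N * (?H (s + k) - ?H s) \<le> int k * P + N"
      if "s + k < n" "0 < k" for s
      using mid[of s k] pre[of k] that N H0 by (cases "s = 0") auto
    from this[of i] this[of j]
    show "\<bar>height ?w (i + k) - height ?w i - (height ?w (j + k) - height ?w j)\<bar> \<le> 1"
      using a h by (cases "k = 0") (auto intro!: close)
  qed
  moreover have "\<not> balanced ?w"
  proof
    assume bal: "balanced ?w"
    define d where "d = gcd p n"
    have d: "d > 1" using assms by (simp add: d_def coprime_iff_gcd_eq_1 nat_neq_iff)
    obtain k where k: "n = d * k" by (metis d_def dvdE gcd_dvd2)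
    obtain m where m: "p = d * m" by (metis d_def dvdE gcd_dvd1)
    have "0 < k" using k assms by (cases k) auto
    then have k0: "0 < k" "k < n" using k d by auto
    have "int k * P = N * int m" by (simp add: N_def P_def k m)
    with pre[OF k0] suf[of "n - k" k] k0
    have "N * int m < N * ?H k" "N * (?H n - ?H (n - k)) < N * int m" by auto
    then have "int m < ?H k" "?H n - ?H (n - k) < int m"
      using N by (auto simp: mult_less_cancel_left)
    then show False
      using bal[unfolded balanced_iff_height, rule_format, of 0 k "n - k"] k0 h H0 by simp
  qed
  ultimately show ?thesis by (simp add: minimal_forbidden_iff_ends)
qed

section \<open>Classification and counting\<close>

lemma minimal_forbidden_exceptional:
  assumes w: "w \<in> minimal_forbidden_words St" and len: "length w = n" and "k < n"
    and D: "height w k - (height w n - height w (n - k)) \<ge> 2"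
  obtains p where "0 < p" "p < n" "\<not> coprime p n" "w = exceptional_word n p"
proof -
  let ?h = "height w"
  note ends = w[unfolded minimal_forbidden_iff_ends balanced_tl_iff balanced_butlast_iff len]
  obtain d where d: "d > 1" "d dvd n" "int d dvd ?h n"
    and b: "\<And>i. 0 < i \<Longrightarrow> i < n \<Longrightarrow> int n * (?h i - 1) \<le> int i * ?h n \<and> int i * ?h n < int n * ?h i"
  proof (rule unbalanced_height_form[of ?h n])
    show "?h i \<le> ?h (Suc i) \<and> ?h (Suc i) \<le> ?h i + 1" if "i < n" for i
      using that len by (simp add: height_Suc)
    show "\<exists>k<n. 2 \<le> ?h k - (?h n - ?h (n - k))" using assms by blast
  qed (use ends in auto)
  define p where "p = count_list w A"
  have hp: "?h n = int p" using len by (simp add: height_def p_def)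
  have "\<not> coprime p n"
    using d hp by (metis int_dvd_int_iff coprime_common_divisor_nat less_numeral_extra(4))
  have le: "?h i \<le> int i" for i
    using count_le_length[of "take i w" A] by (simp add: height_def)
  \<comment> \<open>Over a single letter, factors of equal length have equal counts, against the
    excess in \<open>D\<close>; this excludes both extreme values of \<open>p\<close>.\<close>
  have "p \<noteq> 0"
  proof
    assume "p = 0"
    then have "A \<notin> set w" by (simp add: p_def count_list_0_iff)
    then have "?h i = 0" for i
      by (auto simp: height_def count_list_0_iff dest: in_set_takeD)
    then show False using D by simp
  qed
  moreover have "p \<noteq> n"
    using le[of k] le[of "n - k"] D hp \<open>k < n\<close> by auto
  moreover have "p \<le> n" using le[of n] hp by simp
  ultimately have p: "0 < p" "p < n" by auto
  have "w = exceptional_word n p"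
  proof (rule height_inject)
    fix i assume "i \<le> length (exceptional_word n p)"
    then have i: "i \<le> n" by simp
    consider "i = 0" | "i = n" | "0 < i" "i < n" using i by linarith
    then have "?h i = exceptional_height n p i"
    proof cases
      case 3
      show ?thesis
      proof (rule height_bounds_unique[of "int n" _ "int i * int p"])
      qed (use 3 b[OF 3] exceptional_height_bounds[OF 3, of p] hp in auto)
    qed (use p hp in \<open>auto simp: exceptional_height_def\<close>)
    then show "?h i = height (exceptional_word n p) i"
      using height_exceptional_word[OF p i] by simp
  qed (use len in simp)
  with that p \<open>\<not> coprime p n\<close> show thesis by blast
qed

lemma minimal_forbidden_words_eq:
  "{w \<in> minimal_forbidden_words St. length w = n} =
     exceptional_word n ` {p. 0 < p \<and> p < n \<and> \<not> coprime p n} \<union>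
     (\<lambda>p. rev (exceptional_word n p)) ` {p. 0 < p \<and> p < n \<and> \<not> coprime p n}" (is "?L = ?R")
proof (intro equalityI subsetI)
  fix w assume "w \<in> ?L"
  then have w: "w \<in> minimal_forbidden_words St" and len: "length w = n" by auto
  let ?h = "height w"
  have "\<not> balanced w" "balanced (tl w)" "balanced (butlast w)"
    using w by (auto simp: minimal_forbidden_iff_ends)
  note ends = this(1)[unfolded balanced_iff_height len] this(2)[unfolded balanced_tl_iff len]
    this(3)[unfolded balanced_butlast_iff len]
  from ends(1) obtain i j k where ijk: "i + k \<le> n" "j + k \<le> n"
    and un: "\<not> \<bar>(?h (i + k) - ?h i) - (?h (j + k) - ?h j)\<bar> \<le> 1" by auto
  \<comment> \<open>The two factors cannot both lie in \<open>tl w\<close> or both in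
    \<open>butlast w\<close>, so one is a prefix and the other a suffix.\<close>
  have "\<not> (0 < i \<and> 0 < j)" "\<not> (i + k < n \<and> j + k < n)" using ends(2,3) ijk un by blast+
  then have ij: "(i = 0 \<and> j = n - k) \<or> (j = 0 \<and> i = n - k)" using ijk by linarith
  have "k \<noteq> n" using ijk un by auto
  then have k: "k < n" using ijk by simp
  from ij un ijk have "?h k - (?h n - ?h (n - k)) \<ge> 2 \<or> ?h k - (?h n - ?h (n - k)) \<le> - 2"
    by auto
  then show "w \<in> ?R"
  proof
    assume "?h k - (?h n - ?h (n - k)) \<ge> 2"
    from minimal_forbidden_exceptional[OF w len k this] show ?thesis by blast
  next
    \<comment> \<open>Reversal changes the sign of this difference.\<close>
    assume D: "?h k - (?h n - ?h (n - k)) \<le> - 2"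
    have "height (rev w) k - (height (rev w) n - height (rev w) (n - k)) \<ge> 2"
      using D k len by (simp add: height_rev)
    from minimal_forbidden_exceptional[OF _ _ k this] w len
    obtain p where "0 < p" "p < n" "\<not> coprime p n" "rev w = exceptional_word n p"
      by (auto simp: minimal_forbidden_rev)
    moreover from this have "w = rev (exceptional_word n p)" by (metis rev_rev_ident)
    ultimately show ?thesis by blast
  qed
qed (auto simp: exceptional_word_minimal_forbidden minimal_forbidden_rev)

theorem corollary5p2:
  fixes n :: nat
  assumes "n > 1"
  shows "int (card {w \<in> minimal_forbidden_words St. length w = n})
           = 2 * (int n - 1 - int (totient n))"
proof -
  define S where "S = {p. 0 < p \<and> p < n \<and> \<not> coprime p n}"
  have fin: "finite S" by (simp add: S_def)
  have inj: "inj_on (exceptional_word n) S"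
  proof (rule inj_onI)
    fix p q assume "p \<in> S" "q \<in> S" and eq: "exceptional_word n p = exceptional_word n q"
    then have "exceptional_height n p n = exceptional_height n q n"
      using height_exceptional_word[of p n n] height_exceptional_word[of q n n] by (simp add: S_def)
    then show "p = q" using assms by (simp add: exceptional_height_def)
  qed
  then have inj': "inj_on (\<lambda>p. rev (exceptional_word n p)) S"
    by (auto simp: inj_on_def)
  \<comment> \<open>The first letter separates the families: \<open>A\<close> in
    \<open>exceptional_word n p\<close>, and \<open>B\<close> in its reversal because the height is
    already \<open>p\<close> at \<open>n - 1\<close>.\<close>
  have one: "height (exceptional_word n p) 1 = 1" if "p \<in> S" for p
    using that assms height_exceptional_word[of p n 1]
    by (simp add: S_def exceptional_height_def)
  have rev_one: "height (rev (exceptional_word n p)) 1 = 0" if "p \<in> S" for p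
  proof -
    have p: "0 < p" "p < n" using that by (auto simp: S_def)
    have "exceptional_height n p (n - 1) = int p"
    proof (rule height_bounds_unique[of "int n" _ "int (n - 1) * int p"])
      show "int n * (int p - 1) \<le> int (n - 1) * int p" "int (n - 1) * int p < int n * int p"
        using p by (auto simp: of_nat_diff algebra_simps)
    qed (use assms exceptional_height_bounds[of "n - 1" n p] in auto)
    then show ?thesis
      using assms height_exceptional_word[OF p] p
      by (simp add: height_rev) (simp add: exceptional_height_def)
  qed
  have disj: "exceptional_word n ` S \<inter> (\<lambda>p. rev (exceptional_word n p)) ` S = {}"
    using one rev_one by (metis (no_types, lifting) disjoint_iff imageE zero_neq_one)
  have "card {w \<in> minimal_forbidden_words St. length w = n} = 2 * card S"
    unfolding minimal_forbidden_words_eq S_def[symmetric]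
    using fin disj by (simp add: card_Un_disjoint card_image inj inj')
  moreover have "card S + totient n = n - 1"
  proof -
    \<comment> \<open>As \<open>n > 1\<close>, all totatives lie strictly between 0 and
      \<open>n\<close>, and \<open>S\<close> is their complement there.\<close>
    have "n \<notin> totatives n" using assms by (simp add: totatives_def)
    then have "S \<union> totatives n = {0<..<n}" "S \<inter> totatives n = {}"
      by (auto simp: S_def totatives_def order.order_iff_strict)
    then have "card S + card (totatives n) = card {0<..<n}"
      using fin by (metis card_Un_disjoint finite_totatives)
    then show ?thesis by (simp add: totient_def)
  qed
  ultimately show ?thesis using assms by simp
qed

end
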